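(* Let $X$ be a finite-dimensional normed linear space, let $A,B\subset X$ be closed, and let $\bar x\in A\cap B$. The following conditions are equivalent: (i) $\{A,B\}$ is intrinsically transversal at $\bar x$; (ii) there exists a number $\alpha\in]0,1[$ such that $\|x_1^*+x_2^*\|>\alpha$ for all $(x_1^*,x_2^* )\in\overline N_{A,B}(\bar x)$ satisfying $\|x_1^*\|+\|x_2^*\|=1$; (iii) $\{x^*\in X^*\mid (x^*,-x^* )\in\overline N_{A,B}(\bar x)\}\subset\{0\}$. Moreover, the supremum of all $\alpha$ in (ii) equals $\mathrm{itr}[A,B](\bar x)$ (with the convention $\sup\emptyset=0$).
   Context: $\mathbb{B}_r(x)$ is the open ball with centre $x$ and radius $r$. Fréchet normal cone to $A$ at $x\in A$: $N_A(x)=\{x^*\in X^*\mid \limsup_{a\to x,\,a\in A\setminus\{x\}}\langle x^*,a-x\rangle/\|a-x\|\le 0\}$ (all of $X^*$ if $x$ is isolated in $A$). The constant $\mathrm{itr}[A,B](\bar x)$: for $\delta>0$ let $I(\delta)$ be the infimum of $\|x_1^*+x_2^*\|$ over all $a\in(A\setminus B)\cap\mathbb{B}_\delta(\bar x)$, $b\in(B\setminus A)\cap\mathbb{B}_\delta(\bar x)$, $x\in\mathbb{B}_\delta(\bar x)$ with $x\ne a$, $x\ne b$, $1-\delta<\frac{\|x-a\|}{\|x-b\|}<1+\delta$, and all $x_1^*\in N_A(a)\setminus\{0\}$, $x_2^*\in N_B(b)\setminus\{0\}$ with $\|x_1^*\|+\|x_2^*\|=1$, $\frac{\langle x_1^*,x-a\rangle}{\|x_1^*\|\|x-a\|}>1-\delta$,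 $\frac{\langle x_2^*,x-b\rangle}{\|x_2^*\|\|x-b\|}>1-\delta$, where the infimum over the empty set equals $1$. Then $\mathrm{itr}[A,B](\bar x):=\lim_{\delta\downarrow0}I(\delta)$. The pair $\{A,B\}$ is intrinsically transversal at $\bar x$ if $\mathrm{itr}[A,B](\bar x)>0$. Pairs of relative limiting normals: $(x_1^*,x_2^* )\in X^*\times X^*$ belongs to $\overline N_{A,B}(\bar x)$ if there exist sequences $(a_k)\subset A\setminus B$, $(b_k)\subset B\setminus A$, $(x_k)\subset X$, $(x_{1k}^* ),(x_{2k}^* )\subset X^*$ such that $x_k\ne a_k$, $x_k\neq b_k$ for all $k$, $a_k\to\bar x$, $b_k\to\bar x$, $x_k\to\bar x$, $x_{1k}^*\to x_1^*$, $x_{2k}^*\to x_2^*$, $x_{1k}^*\in N_A(a_k)$, $x_{2k}^*\in N_B(b_k)$ for all $k$, and $$\frac{\|x_k-a_k\|}{\|x_k-b_k\|}\to1,\quad \frac{\langle x_{1k}^*,x_k-a_k\rangle}{\|x_{1k}^*\|\|x_k-a_k\|}\to1,\quad \frac{\langle x_{2k}^*,x_k-b_k\rangle}{\|x_{2k}^*\|\|x_k-b_k\|}\to1,$$ with the convention $\frac00=1$. *)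

theory Defs
  imports "HOL-Analysis.Analysis"
begin

text \<open>The dual space of \<open>X\<close> is \<open>'a \<Rightarrow>\<^sub>L real\<close> with the operator norm. In the definition below, an isolated
  point \<open>x\<close> of \<open>A\<close> has \<open>at x within A = bot\<close>, so that the upper limit is \<open>-\<infinity>\<close> and the cone is the
  whole dual space. The definition is meant for \<open>x \<in> A\<close> and only used there.\<close>

definition frechet_normal_cone :: "'a::real_normed_vector set \<Rightarrow> 'a \<Rightarrow> ('a \<Rightarrow>\<^sub>L real) set" where
  "frechet_normal_cone A x =
    {x'. Limsup (at x within A) (\<lambda>a. ereal (blinfun_apply x' (a - x) / norm (a - x))) \<le> 0}"

definition itr_values ::
  "'a::real_normed_vector set \<Rightarrow> 'a set \<Rightarrow> 'a \<Rightarrow> real \<Rightarrow> real set" where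
  "itr_values A B xbar \<delta> =
    {norm (x1 + x2) | a b x x1 x2.
       a \<in> (A - B) \<inter> ball xbar \<delta> \<and> b \<in> (B - A) \<inter> ball xbar \<delta> \<and> x \<in> ball xbar \<delta> \<and>
       x \<noteq> a \<and> x \<noteq> b \<and>
       1 - \<delta> < norm (x - a) / norm (x - b) \<and> norm (x - a) / norm (x - b) < 1 + \<delta> \<and>
       x1 \<in> frechet_normal_cone A a - {0} \<and> x2 \<in> frechet_normal_cone B b - {0} \<and>
       norm x1 + norm x2 = 1 \<and>
       blinfun_apply x1 (x - a) / (norm x1 * norm (x - a)) > 1 - \<delta> \<and>
       blinfun_apply x2 (x - b) / (norm x2 * norm (x - b)) > 1 - \<delta>}"

definition itr_inf ::
  "'a::real_normed_vector set \<Rightarrow> 'a set \<Rightarrow> 'a \<Rightarrow> real \<Rightarrow> real" where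
  "itr_inf A B xbar \<delta> =
    (if itr_values A B xbar \<delta> = {} then 1 else Inf (itr_values A B xbar \<delta>))"

text \<open>The limit below always exists: \<open>itr_inf A B xbar\<close> is antitone on the positive reals, with values
  in \<open>[0, 1]\<close>.\<close>

definition itr :: "'a::real_normed_vector set \<Rightarrow> 'a set \<Rightarrow> 'a \<Rightarrow> real" where
  "itr A B xbar = Lim (at_right 0) (itr_inf A B xbar)"

definition intrinsically_transversal ::
  "'a::real_normed_vector set \<Rightarrow> 'a set \<Rightarrow> 'a \<Rightarrow> bool" where
  "intrinsically_transversal A B xbar \<longleftrightarrow> itr A B xbar > 0"

text \<open>Division with the convention \<open>0 / 0 = 1\<close>. It matters only for zero functionals, which are
  admitted in the sequences of normals below.\<close>

definition quot1 :: "real \<Rightarrow> real \<Rightarrow> real" where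
  "quot1 p q = (if p = 0 \<and> q = 0 then 1 else p / q)"

definition rel_limiting_normals ::
  "'a::real_normed_vector set \<Rightarrow> 'a set \<Rightarrow> 'a \<Rightarrow> (('a \<Rightarrow>\<^sub>L real) \<times> ('a \<Rightarrow>\<^sub>L real)) set" where
  "rel_limiting_normals A B xbar =
    {(x1, x2). \<exists>(a :: nat \<Rightarrow> 'a) b x (u :: nat \<Rightarrow> 'a \<Rightarrow>\<^sub>L real) v.
       (\<forall>k. a k \<in> A - B \<and> b k \<in> B - A \<and> x k \<noteq> a k \<and> x k \<noteq> b k \<and>
            u k \<in> frechet_normal_cone A (a k) \<and> v k \<in> frechet_normal_cone B (b k)) \<and>
       a \<longlonglongrightarrow> xbar \<and> b \<longlonglongrightarrow> xbar \<and> x \<longlonglongrightarrow> xbar \<and> u \<longlonglongrightarrow> x1 \<and> v \<longlonglongrightarrow> x2 \<and>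
       (\<lambda>k. quot1 (norm (x k - a k)) (norm (x k - b k))) \<longlonglongrightarrow> 1 \<and>
       (\<lambda>k. quot1 (blinfun_apply (u k) (x k - a k)) (norm (u k) * norm (x k - a k))) \<longlonglongrightarrow> 1 \<and>
       (\<lambda>k. quot1 (blinfun_apply (v k) (x k - b k)) (norm (v k) * norm (x k - b k))) \<longlonglongrightarrow> 1}"

definition Sup0 :: "real set \<Rightarrow> real" where
  "Sup0 S = (if S = {} then 0 else Sup S)"

end

theory Submission
  imports Defs
begin

text \<open>
  Write \<open>L\<close> for \<open>itr A B xbar\<close> and call a pair of relative limiting normals normalized if its norms add
  up to \<open>1\<close>. All claims follow from one description of \<open>L\<close>: it is the minimum of \<open>1\<close> and the numbers
  \<open>norm (x1 + x2)\<close> over the normalized pairs.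

  No pair beats \<open>L\<close> (\<open>itr_le_norm_add_of_rel_limiting_normals\<close>): if \<open>x1\<close> and \<open>x2\<close> are nonzero, then the
  normals in a sequence that defines \<open>(x1, x2)\<close> are eventually nonzero. As normal cones are cones and the
  quotients are invariant under positive scaling, the sequence can be rescaled so that each pair of
  normals is normalized. Its tail is then admissible in the infimum for every \<open>\<delta>\<close>. If \<open>x1\<close> or \<open>x2\<close> is
  zero, then \<open>norm (x1 + x2)\<close> is the sum of the norms, and \<open>L \<le> 1\<close> is enough. This case collects
  everything that the convention \<open>0 / 0 = 1\<close> can add.

  The value \<open>L\<close> is \<open>1\<close> or attained (\<open>itr_attained\<close>): if admissible tuples exist for all \<open>\<delta>\<close>, almost
  minimal ones along \<open>\<delta> \<rightarrow> 0\<close> have normals in the unit ball of the dual space, which is compact because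
  the space has finite dimension. The limit of a subsequence is a normalized pair with
  \<open>norm (x1 + x2) = L\<close>.

  Hence a number \<open>\<alpha> < 1\<close> satisfies the bound in (ii) exactly if \<open>\<alpha> < L\<close>, so the numbers in (ii) form the
  interval \<open>{0<..<L}\<close>. A pair \<open>(x', - x')\<close> with \<open>x' \<noteq> 0\<close> forces \<open>L \<le> 0\<close>, and if \<open>L = 0\<close>, the pair that
  attains it is of this form; this is (iii).
\<close>

section \<open>Sequential compactness in a finite-dimensional space and in its dual\<close>

definition bounded_sequences_converge_in :: "'a::real_normed_vector set \<Rightarrow> bool" where
  "bounded_sequences_converge_in V \<longleftrightarrow>
     (\<forall>y. range y \<subseteq> V \<longrightarrow> bounded (range y) \<longrightarrow>
        (\<exists>l\<in>V. \<exists>r::nat \<Rightarrow> nat. strict_mono r \<and> (\<lambda>k. y (r k)) \<longlonglongrightarrow> l))"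

lemma bounded_sequences_converge_in_imp_closed:
  assumes "bounded_sequences_converge_in V"
  shows "closed V"
proof (unfold closed_sequential_limits, intro allI impI, elim conjE)
  fix y l assume y: "\<forall>n. y n \<in> V" and lim: "y \<longlonglongrightarrow> l"
  have "bounded (range y)" using lim convergent_imp_bounded by blast
  then obtain l' r where "l' \<in> V" and r: "strict_mono (r :: nat \<Rightarrow> nat)" and "(\<lambda>k. y (r k)) \<longlonglongrightarrow> l'"
    using assms y unfolding bounded_sequences_converge_in_def by blast
  moreover have "(\<lambda>k. y (r k)) \<longlonglongrightarrow> l"
    using LIMSEQ_subseq_LIMSEQ[OF lim r] by (simp add: o_def)
  ultimately show "l \<in> V" using LIMSEQ_unique by blast
qed

text \<open>Bolzano-Weierstrass in the span of a finite set, by induction on the set, for a norm that comes with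
  no coordinates. When a vector \<open>b\<close> outside \<open>span S\<close> is added, the induction hypothesis makes
  \<open>span S\<close> closed, so \<open>b\<close> has a positive distance \<open>d\<close> from it. The coefficient of \<open>b\<close> in a vector \<open>y\<close> is
  then at most \<open>norm y / d\<close>, and both the coefficients and the components in \<open>span S\<close> of a bounded
  sequence stay bounded.\<close>

lemma bounded_sequences_converge_in_span:
  assumes "finite S"
  shows "bounded_sequences_converge_in (span S)"
  using assms
proof induction
  case empty
  show ?case
    unfolding bounded_sequences_converge_in_def
  proof (intro allI impI)
    fix y :: "nat \<Rightarrow> 'a" assume "range y \<subseteq> span {}"
    then have "y = (\<lambda>k. 0)" by auto
    then have "strict_mono (id :: nat \<Rightarrow> nat)" "(\<lambda>k. y (id k)) \<longlonglongrightarrow> 0"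
      by (auto simp: strict_mono_def)
    then show "\<exists>l\<in>span {}. \<exists>r::nat \<Rightarrow> nat. strict_mono r \<and> (\<lambda>k. y (r k)) \<longlonglongrightarrow> l"
      using span_zero by blast
  qed
next
  case (insert b S)
  show ?case
  proof (cases "b \<in> span S")
    case True
    then show ?thesis using insert.IH by (simp add: span_redundant)
  next
    case False
    define d where "d = infdist b (span S)"
    have "d > 0"
      unfolding d_def
      using bounded_sequences_converge_in_imp_closed[OF insert.IH] False span_zero
      by (metis empty_iff infdist_nonneg in_closed_iff_infdist_zero less_eq_real_def)
    have coeff_le: "\<bar>c\<bar> * d \<le> norm y" if "y - c *\<^sub>R b \<in> span S" for y c
    proof (cases "c = 0")
      case False
      define s where "s = y - c *\<^sub>R b"
      have "- (1 / c) *\<^sub>R s \<in> span S" using that unfolding s_def by (rule span_scale)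
      then have "d \<le> dist b (- (1 / c) *\<^sub>R s)" unfolding d_def by (rule infdist_le)
      also have "\<dots> = norm ((1 / c) *\<^sub>R y)"
        unfolding dist_norm s_def using False by (simp add: algebra_simps)
      finally show ?thesis using False by (simp add: field_simps)
    qed simp
    show ?thesis
      unfolding bounded_sequences_converge_in_def
    proof (intro allI impI)
      fix y :: "nat \<Rightarrow> 'a" assume y: "range y \<subseteq> span (insert b S)" and "bounded (range y)"
      then obtain K where K: "\<And>k. norm (y k) \<le> K" unfolding bounded_iff by blast
      have "\<forall>k. \<exists>c. y k - c *\<^sub>R b \<in> span S"
        using y span_breakdown_eq[of _ b S] by blast
      then obtain c where c: "\<And>k. y k - c k *\<^sub>R b \<in> span S" by metis
      have "norm (c k) \<le> K / d" for k
        using coeff_le[OF c[of k]] K[of k] \<open>d > 0\<close> by (simp add: field_simps)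
      then have "bounded (range c)" unfolding bounded_iff by blast
      then obtain c0 r where r: "strict_mono (r :: nat \<Rightarrow> nat)" and c0: "(\<lambda>k. c (r k)) \<longlonglongrightarrow> c0"
        using bounded_imp_convergent_subsequence[of c] by (auto simp: o_def)
      define s where "s k = y (r k) - c (r k) *\<^sub>R b" for k
      have "norm (s k) \<le> K + K / d * norm b" for k
      proof -
        have "norm (s k) \<le> norm (y (r k)) + norm (c (r k) *\<^sub>R b)"
          unfolding s_def by (rule norm_triangle_ineq4)
        also have "\<dots> \<le> K + K / d * norm b"
          using K[of "r k"] mult_right_mono[OF \<open>\<And>k. norm (c k) \<le> K / d\<close>[of "r k"], of "norm b"]
          by simp
        finally show ?thesis .
      qed
      then have "bounded (range s)" unfolding bounded_iff by blast
      moreover have "range s \<subseteq> span S" using c unfolding s_def by auto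
      ultimately obtain s0 q where "s0 \<in> span S" and q: "strict_mono (q :: nat \<Rightarrow> nat)"
        and s0: "(\<lambda>k. s (q k)) \<longlonglongrightarrow> s0"
        using insert.IH unfolding bounded_sequences_converge_in_def by blast
      have "(\<lambda>k. s (q k) + c (r (q k)) *\<^sub>R b) \<longlonglongrightarrow> s0 + c0 *\<^sub>R b"
        using s0 LIMSEQ_subseq_LIMSEQ[OF c0 q] by (intro tendsto_intros) (auto simp: o_def)
      then have "(\<lambda>k. y ((r \<circ> q) k)) \<longlonglongrightarrow> s0 + c0 *\<^sub>R b" unfolding s_def by simp
      moreover have "strict_mono (r \<circ> q)" using r q by (rule strict_mono_o)
      moreover have "s0 + c0 *\<^sub>R b \<in> span (insert b S)"
        using \<open>s0 \<in> span S\<close> by (auto simp: span_breakdown_eq[of _ b S] intro!: exI[of _ c0])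
      ultimately show "\<exists>l\<in>span (insert b S). \<exists>r::nat \<Rightarrow> nat. strict_mono r \<and> (\<lambda>k. y (r k)) \<longlonglongrightarrow> l"
        by blast
    qed
  qed
qed

lemma pointwise_convergent_subsequence_on_finite:
  fixes u :: "nat \<Rightarrow> 'a::real_normed_vector \<Rightarrow>\<^sub>L real"
  assumes "finite S" and bdd: "\<And>k. norm (u k) \<le> K"
  shows "\<exists>r::nat \<Rightarrow> nat. strict_mono r \<and> (\<forall>s\<in>S. convergent (\<lambda>k. u (r k) s))"
  using assms(1)
proof induction
  case empty
  show ?case by (auto intro!: exI[of _ id] simp: strict_mono_def)
next
  case (insert s S)
  then obtain r where r: "strict_mono (r :: nat \<Rightarrow> nat)"
    and conv: "\<And>t. t \<in> S \<Longrightarrow> convergent (\<lambda>k. u (r k) t)" by blast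
  have "norm (u (r k) s) \<le> K * norm s" for k
    using norm_blinfun[of "u (r k)" s] bdd[of "r k"] by (meson mult_right_mono norm_ge_zero order_trans)
  then have "bounded (range (\<lambda>k. u (r k) s))" unfolding bounded_iff by blast
  then obtain l q where q: "strict_mono (q :: nat \<Rightarrow> nat)" and "(\<lambda>k. u (r (q k)) s) \<longlonglongrightarrow> l"
    using bounded_imp_convergent_subsequence[of "\<lambda>k. u (r k) s"] by (auto simp: o_def)
  moreover have "convergent (\<lambda>k. u (r (q k)) t)" if "t \<in> S" for t
    using convergent_subseq_convergent[OF conv[OF that] q] by (simp add: o_def)
  moreover have "strict_mono (r \<circ> q)" using r q by (rule strict_mono_o)
  ultimately show ?case
    by (intro exI[of _ "r \<circ> q"]) (auto simp: convergent_def simp del: o_apply, auto simp: o_def)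
qed

text \<open>The points at which a sequence of functionals converges form a subspace, so convergence on a
  spanning set is convergence everywhere. The common norm bound passes to the limit, which is therefore
  a continuous functional.\<close>

lemma dual_pointwise_limit:
  fixes u :: "nat \<Rightarrow> 'a::real_normed_vector \<Rightarrow>\<^sub>L real"
  assumes span: "span S = UNIV" and bdd: "\<And>k. norm (u k) \<le> K"
    and conv: "\<And>s. s \<in> S \<Longrightarrow> convergent (\<lambda>k. u k s)"
  obtains l :: "'a \<Rightarrow>\<^sub>L real" where "\<And>x. (\<lambda>k. u k x) \<longlonglongrightarrow> l x"
proof -
  have "convergent (\<lambda>k. u k x)" for x
  proof -
    have "x \<in> span S" using span by simp
    then show ?thesis
    proof (induction rule: span_induct_alt)
      case base
      show ?case by (simp add: convergent_const)
    next
      case (step c s y)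
      then show ?case
        by (simp add: blinfun.add_right blinfun.scaleR_right convergent_add convergent_mult
            convergent_const conv)
    qed
  qed
  then have lim: "(\<lambda>k. u k x) \<longlonglongrightarrow> lim (\<lambda>k. u k x)" for x
    by (simp add: convergent_LIMSEQ_iff)
  have "bounded_linear (\<lambda>x. lim (\<lambda>k. u k x))"
  proof (rule bounded_linear_intro[where K = K])
    fix x y
    have "(\<lambda>k. u k x + u k y) \<longlonglongrightarrow> lim (\<lambda>k. u k x) + lim (\<lambda>k. u k y)"
      by (intro tendsto_intros lim)
    then show "lim (\<lambda>k. u k (x + y)) = lim (\<lambda>k. u k x) + lim (\<lambda>k. u k y)"
      by (simp add: limI blinfun.add_right)
  next
    fix c x
    have "(\<lambda>k. c *\<^sub>R u k x) \<longlonglongrightarrow> c *\<^sub>R lim (\<lambda>k. u k x)"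
      by (intro tendsto_intros lim)
    then show "lim (\<lambda>k. u k (c *\<^sub>R x)) = c *\<^sub>R lim (\<lambda>k. u k x)"
      by (simp add: limI blinfun.scaleR_right)
  next
    fix x
    have "norm (u k x) \<le> norm x * K" for k
      using norm_blinfun[of "u k" x] bdd[of k]
      by (metis mult.commute mult_right_mono norm_ge_zero order_trans)
    then show "norm (lim (\<lambda>k. u k x)) \<le> norm x * K"
      using tendsto_norm[OF lim[of x]] LIMSEQ_le_const2 by blast
  qed
  then have "blinfun_apply (Blinfun (\<lambda>x. lim (\<lambda>k. u k x))) = (\<lambda>x. lim (\<lambda>k. u k x))"
    by (rule bounded_linear_Blinfun_apply)
  with lim that show ?thesis by metis
qed

text \<open>Half of the norm is a bound that is easy to reach on the unit ball of any normed space; it turns an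
  estimate of the operator norm into an estimate at a single point.\<close>

lemma exists_almost_norming_vector:
  fixes w :: "'a::real_normed_vector \<Rightarrow>\<^sub>L real"
  obtains z where "norm z \<le> 1" and "norm w \<le> 2 * \<bar>w z\<bar>"
proof (cases "w = 0")
  case True
  then show ?thesis using that[of 0] by simp
next
  case False
  have "\<exists>x. \<bar>w x\<bar> > norm w / 2 * norm x"
  proof (rule ccontr)
    assume "\<not> ?thesis"
    then have "norm w \<le> norm w / 2"
      by (intro norm_blinfun_bound) (auto simp: not_less)
    then show False using False by simp
  qed
  then obtain x where x: "\<bar>w x\<bar> > norm w / 2 * norm x" by blast
  then have "x \<noteq> 0" by auto
  then show ?thesis
    using x by (intro that[of "(1 / norm x) *\<^sub>R x"]) (auto simp: blinfun.scaleR_right field_simps)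
qed

text \<open>A finite spanning set gives a pointwise convergent subsequence. Convergence in norm follows from the
  compactness of the unit ball: along a further subsequence, points \<open>z k\<close> that almost realize the norms
  of the differences \<open>w k\<close> converge to some \<open>z0\<close>, and \<open>w k (z k)\<close> is controlled by \<open>w k z0\<close>, which tends to
  zero, and by the distance from \<open>z k\<close> to \<open>z0\<close>.\<close>

lemma dual_bounded_sequence_has_convergent_subsequence:
  fixes u :: "nat \<Rightarrow> 'a::real_normed_vector \<Rightarrow>\<^sub>L real"
  assumes fin: "\<exists>S :: 'a set. finite S \<and> span S = UNIV" and bdd: "\<And>k. norm (u k) \<le> K"
  obtains l r where "strict_mono (r :: nat \<Rightarrow> nat)" and "(\<lambda>k. u (r k)) \<longlonglongrightarrow> l"
proof -
  obtain S :: "'a set" where S: "finite S" "span S = UNIV" using fin by blast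
  obtain r where r: "strict_mono (r :: nat \<Rightarrow> nat)" and conv: "\<And>s. s \<in> S \<Longrightarrow> convergent (\<lambda>k. u (r k) s)"
    using pointwise_convergent_subsequence_on_finite[of S u K, OF S(1) bdd] by blast
  obtain l where l: "\<And>x. (\<lambda>k. u (r k) x) \<longlonglongrightarrow> blinfun_apply l x"
    using dual_pointwise_limit[OF S(2) bdd conv] by metis
  define w where "w k = u (r k) - l" for k
  have w_bdd: "norm (w k) \<le> K + norm l" for k
    unfolding w_def using norm_triangle_ineq4[of "u (r k)" l] bdd[of "r k"] by linarith
  obtain z where z: "\<And>k. norm (z k) \<le> 1" and wz: "\<And>k. norm (w k) \<le> 2 * \<bar>w k (z k)\<bar>"
  proof -
    have "\<exists>y. norm y \<le> 1 \<and> norm (w k) \<le> 2 * \<bar>w k y\<bar>" for k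
      using exists_almost_norming_vector by blast
    then show ?thesis using that by metis
  qed
  have "bounded (range z)" using z unfolding bounded_iff by blast
  then obtain z0 q where q: "strict_mono (q :: nat \<Rightarrow> nat)" and z0: "(\<lambda>k. z (q k)) \<longlonglongrightarrow> z0"
    using bounded_sequences_converge_in_span[OF S(1)] S(2)
    unfolding bounded_sequences_converge_in_def by (metis top_greatest)
  have "(\<lambda>k. w (q k)) \<longlonglongrightarrow> 0"
  proof (rule Lim_null_comparison)
    have "norm (w (q k)) \<le> 2 * (\<bar>w (q k) z0\<bar> + (K + norm l) * norm (z (q k) - z0))" for k
    proof -
      have "w (q k) (z (q k)) = w (q k) z0 + w (q k) (z (q k) - z0)"
        by (simp add: blinfun.diff_right)
      moreover have "\<bar>w (q k) (z (q k) - z0)\<bar> \<le> (K + norm l) * norm (z (q k) - z0)"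
        using norm_blinfun[of "w (q k)" "z (q k) - z0"] w_bdd[of "q k"]
        by (smt (verit) mult_right_mono norm_ge_zero real_norm_def)
      ultimately have "\<bar>w (q k) (z (q k))\<bar> \<le> \<bar>w (q k) z0\<bar> + (K + norm l) * norm (z (q k) - z0)"
        using abs_triangle_ineq[of "w (q k) z0" "w (q k) (z (q k) - z0)"] by linarith
      then have "2 * \<bar>w (q k) (z (q k))\<bar> \<le> 2 * (\<bar>w (q k) z0\<bar> + (K + norm l) * norm (z (q k) - z0))"
        by (rule mult_left_mono) simp
      with wz[of "q k"] show ?thesis by (rule order_trans)
    qed
    then show "\<forall>\<^sub>F k in sequentially.
        norm (w (q k)) \<le> 2 * (\<bar>w (q k) z0\<bar> + (K + norm l) * norm (z (q k) - z0))" by simp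
    have "(\<lambda>k. w k z0) \<longlonglongrightarrow> 0"
      unfolding w_def blinfun.diff_left using l[of z0] by (simp add: LIM_zero)
    then have "(\<lambda>k. w (q k) z0) \<longlonglongrightarrow> 0"
      using LIMSEQ_subseq_LIMSEQ[OF _ q] by (fastforce simp: o_def)
    then have "(\<lambda>k. 2 * (\<bar>w (q k) z0\<bar> + (K + norm l) * norm (z (q k) - z0)))
        \<longlonglongrightarrow> 2 * (\<bar>0\<bar> + (K + norm l) * norm (z0 - z0))"
      using z0 by (intro tendsto_mult tendsto_add tendsto_rabs tendsto_norm tendsto_diff tendsto_const)
    then show "(\<lambda>k. 2 * (\<bar>w (q k) z0\<bar> + (K + norm l) * norm (z (q k) - z0))) \<longlonglongrightarrow> 0"
      by simp
  qed
  then have "(\<lambda>k. u ((r \<circ> q) k)) \<longlonglongrightarrow> l" unfolding w_def by (simp add: LIM_zero_iff)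
  moreover have "strict_mono (r \<circ> q)" using r q by (rule strict_mono_o)
  ultimately show ?thesis using that by blast
qed

section \<open>The limit defining the constant\<close>

lemma itr_values_mono:
  assumes "\<delta> \<le> \<delta>'"
  shows "itr_values A B xbar \<delta> \<subseteq> itr_values A B xbar \<delta>'"
proof
  fix t assume "t \<in> itr_values A B xbar \<delta>"
  then obtain a b x x1 x2 where t: "t = norm (x1 + x2)" 
    and h: "a \<in> (A - B) \<inter> ball xbar \<delta>" "b \<in> (B - A) \<inter> ball xbar \<delta>" "x \<in> ball xbar \<delta>"
       "x \<noteq> a" "x \<noteq> b"
       "1 - \<delta> < norm (x - a) / norm (x - b)" "norm (x - a) / norm (x - b) < 1 + \<delta>"
       "x1 \<in> frechet_normal_cone A a - {0}" "x2 \<in> frechet_normal_cone B b - {0}"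
       "norm x1 + norm x2 = 1"
       "blinfun_apply x1 (x - a) / (norm x1 * norm (x - a)) > 1 - \<delta>"
       "blinfun_apply x2 (x - b) / (norm x2 * norm (x - b)) > 1 - \<delta>"
    unfolding itr_values_def by blast
  have "a \<in> (A - B) \<inter> ball xbar \<delta>'" "b \<in> (B - A) \<inter> ball xbar \<delta>'" "x \<in> ball xbar \<delta>'"
    using h(1-3) subset_ball[OF assms] by blast+
  moreover have "1 - \<delta>' < norm (x - a) / norm (x - b)" "norm (x - a) / norm (x - b) < 1 + \<delta>'"
    "blinfun_apply x1 (x - a) / (norm x1 * norm (x - a)) > 1 - \<delta>'"
    "blinfun_apply x2 (x - b) / (norm x2 * norm (x - b)) > 1 - \<delta>'"
    using h(6,7,11,12) assms by linarith+
  ultimately show "t \<in> itr_values A B xbar \<delta>'"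
    unfolding itr_values_def t using h(4,5,8-10) by blast
qed

lemma itr_values_bounds:
  fixes A B :: "'a::real_normed_vector set"
  assumes "t \<in> itr_values A B xbar \<delta>"
  shows "0 \<le> t" and "t \<le> 1"
proof -
  obtain u v :: "'a \<Rightarrow>\<^sub>L real" where "t = norm (u + v)" "norm u + norm v = 1"
    using assms unfolding itr_values_def by blast
  then show "0 \<le> t" "t \<le> 1" using norm_triangle_ineq[of u v] by simp_all
qed

lemma bdd_below_itr_values: "bdd_below (itr_values A B xbar \<delta>)"
  using itr_values_bounds(1) by (rule bdd_belowI)

lemma itr_inf_le_value:
  assumes "t \<in> itr_values A B xbar \<delta>"
  shows "itr_inf A B xbar \<delta> \<le> t"
  using assms cInf_lower[OF assms bdd_below_itr_values] by (auto simp: itr_inf_def)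

lemma itr_inf_le_1: "itr_inf A B xbar \<delta> \<le> 1"
proof (cases "itr_values A B xbar \<delta> = {}")
  case False
  then obtain t where "t \<in> itr_values A B xbar \<delta>" by blast
  then show ?thesis using itr_inf_le_value[of t] itr_values_bounds(2)[of t] by (meson order_trans)
qed (simp add: itr_inf_def)

lemma itr_inf_nonneg: "0 \<le> itr_inf A B xbar \<delta>"
proof (cases "itr_values A B xbar \<delta> = {}")
  case False
  then have "0 \<le> Inf (itr_values A B xbar \<delta>)" by (rule cInf_greatest) (rule itr_values_bounds(1))
  then show ?thesis using False by (simp add: itr_inf_def)
qed (simp add: itr_inf_def)

lemma itr_inf_antimono:
  assumes "\<delta> \<le> \<delta>'"
  shows "itr_inf A B xbar \<delta>' \<le> itr_inf A B xbar \<delta>"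
proof (cases "itr_values A B xbar \<delta> = {}")
  case True
  then have "itr_inf A B xbar \<delta> = 1" by (simp add: itr_inf_def)
  then show ?thesis using itr_inf_le_1[of A B xbar \<delta>'] by simp
next
  case False
  then have "itr_inf A B xbar \<delta>' \<le> Inf (itr_values A B xbar \<delta>)"
    using itr_values_mono[OF assms] by (blast intro: cInf_greatest itr_inf_le_value)
  then show ?thesis using False by (simp add: itr_inf_def)
qed

text \<open>A monotone bounded function has a one-sided limit, here the supremum. This is what allows the
  limit operator in the definition of \<open>itr\<close> to be used at all.\<close>

lemma itr_inf_tendsto_itr: "(itr_inf A B xbar \<longlongrightarrow> itr A B xbar) (at_right 0)"
proof -
  define L where "L = (SUP \<delta>\<in>{0<..}. itr_inf A B xbar \<delta>)"
  have bdd: "bdd_above (itr_inf A B xbar ` {0<..})"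
    using itr_inf_le_1 by (rule bdd_aboveI2)
  have "(itr_inf A B xbar \<longlongrightarrow> L) (at_right 0)"
  proof (rule order_tendstoI)
    fix c assume "c < L"
    then obtain \<delta> where "\<delta> > 0" "c < itr_inf A B xbar \<delta>"
      unfolding L_def using less_cSUP_iff[OF _ bdd] by auto
    then show "\<forall>\<^sub>F \<delta> in at_right 0. c < itr_inf A B xbar \<delta>"
      unfolding eventually_at_right_field
      using itr_inf_antimono by (metis less_eq_real_def order_less_le_trans)
  next
    fix c assume "L < c"
    then show "\<forall>\<^sub>F \<delta> in at_right 0. itr_inf A B xbar \<delta> < c"
      unfolding eventually_at_right_field L_def
      using cSUP_upper[OF _ bdd] by (intro exI[of _ 1]) fastforce
  qed
  moreover from this have "itr A B xbar = L"
    unfolding itr_def by (intro tendsto_Lim trivial_limit_at_right_real)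
  ultimately show ?thesis by simp
qed

lemma itr_le_1: "itr A B xbar \<le> 1"
  by (rule tendsto_upperbound[OF itr_inf_tendsto_itr])
     (simp_all add: itr_inf_le_1 trivial_limit_at_right_real)

lemma itr_nonneg: "0 \<le> itr A B xbar"
  by (rule tendsto_lowerbound[OF itr_inf_tendsto_itr])
     (simp_all add: itr_inf_nonneg trivial_limit_at_right_real)

section \<open>Comparison with the relative limiting normals\<close>

lemma frechet_normal_cone_scaleR:
  assumes "u \<in> frechet_normal_cone A a" and "c > 0"
  shows "c *\<^sub>R u \<in> frechet_normal_cone A a"
proof -
  have less: "\<forall>\<^sub>F z in at a within A. blinfun_apply u (z - a) / norm (z - a) < e" if "e > 0" for e :: real
  proof -
    have "\<forall>\<^sub>F z in at a within A. ereal (blinfun_apply u (z - a) / norm (z - a)) < ereal e"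
      using assms(1) that unfolding frechet_normal_cone_def mem_Collect_eq Limsup_le_iff
      by (metis ereal_less(2))
    then show ?thesis by simp
  qed
  show ?thesis
    unfolding frechet_normal_cone_def mem_Collect_eq Limsup_le_iff
  proof (intro allI impI)
    fix e :: ereal assume "e > 0"
    then obtain d :: real where "d > 0" and d: "ereal d < e"
      using ereal_dense2[of 0 e] by auto
    have "\<forall>\<^sub>F z in at a within A. blinfun_apply u (z - a) / norm (z - a) < d / c"
      using less \<open>d > 0\<close> \<open>c > 0\<close> by simp
    then show "\<forall>\<^sub>F z in at a within A. ereal (blinfun_apply (c *\<^sub>R u) (z - a) / norm (z - a)) < e"
    proof eventually_elim
      case (elim z)
      then have "blinfun_apply (c *\<^sub>R u) (z - a) / norm (z - a) < d"
        using \<open>c > 0\<close> by (simp add: blinfun.scaleR_left field_simps)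
      then have "ereal (blinfun_apply (c *\<^sub>R u) (z - a) / norm (z - a)) < ereal d" by simp
      also note d
      finally show ?case .
    qed
  qed
qed

lemma itr_le_limit_of_values:
  assumes "t \<longlonglongrightarrow> t0" and "\<And>\<delta>. \<delta> > 0 \<Longrightarrow> \<forall>\<^sub>F k in sequentially. t k \<in> itr_values A B xbar \<delta>"
  shows "itr A B xbar \<le> t0"
proof -
  have "itr_inf A B xbar \<delta> \<le> t0" if "\<delta> > 0" for \<delta>
    using assms(1) _ sequentially_bot
    by (rule tendsto_lowerbound) (rule eventually_mono[OF assms(2)[OF that] itr_inf_le_value])
  then have "\<forall>\<^sub>F \<delta> in at_right 0. itr_inf A B xbar \<delta> \<le> t0"
    by (auto simp: eventually_at_filter)
  then show ?thesis
    by (intro tendsto_upperbound[OF itr_inf_tendsto_itr]) auto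
qed

text \<open>The homogeneous form of the lower bound, which applies as it stands to a pair \<open>(x', - x')\<close> of any
  size. In the proof, the factor \<open>c k\<close> makes the norms of the \<open>k\<close>-th pair of normals add up to \<open>1\<close>.\<close>

lemma itr_le_norm_add_of_rel_limiting_normals:
  assumes "(x1, x2) \<in> rel_limiting_normals A B xbar"
  shows "itr A B xbar * (norm x1 + norm x2) \<le> norm (x1 + x2)"
proof (cases "x1 = 0 \<or> x2 = 0")
  case True
  then have "norm (x1 + x2) = norm x1 + norm x2" by auto
  then show ?thesis
    using mult_right_mono[OF itr_le_1, of "norm x1 + norm x2" A B xbar] by simp
next
  case False
  obtain a b x u v where
    mem: "\<And>k. a k \<in> A - B" "\<And>k. b k \<in> B - A" "\<And>k. x k \<noteq> a k" "\<And>k. x k \<noteq> b k"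
      "\<And>k. u k \<in> frechet_normal_cone A (a k)" "\<And>k. v k \<in> frechet_normal_cone B (b k)"
    and lim: "a \<longlonglongrightarrow> xbar" "b \<longlonglongrightarrow> xbar" "x \<longlonglongrightarrow> xbar" "u \<longlonglongrightarrow> x1" "v \<longlonglongrightarrow> x2"
    and q: "(\<lambda>k. quot1 (norm (x k - a k)) (norm (x k - b k))) \<longlonglongrightarrow> 1"
      "(\<lambda>k. quot1 (blinfun_apply (u k) (x k - a k)) (norm (u k) * norm (x k - a k))) \<longlonglongrightarrow> 1"
      "(\<lambda>k. quot1 (blinfun_apply (v k) (x k - b k)) (norm (v k) * norm (x k - b k))) \<longlonglongrightarrow> 1"
    using assms unfolding rel_limiting_normals_def by blast
  define c where "c k = 1 / (norm (u k) + norm (v k))" for k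
  define t where "t k = norm (c k *\<^sub>R u k + c k *\<^sub>R v k)" for k
  have c0: "norm x1 + norm x2 > 0" using False by (simp add: add_pos_pos)
  have "t \<longlonglongrightarrow> norm ((1 / (norm x1 + norm x2)) *\<^sub>R x1 + (1 / (norm x1 + norm x2)) *\<^sub>R x2)"
    unfolding t_def c_def using c0 by (intro tendsto_intros lim) auto
  also have "norm ((1 / (norm x1 + norm x2)) *\<^sub>R x1 + (1 / (norm x1 + norm x2)) *\<^sub>R x2)
      = norm (x1 + x2) / (norm x1 + norm x2)"
    using c0 by (simp flip: scaleR_add_right)
  finally have t: "t \<longlonglongrightarrow> norm (x1 + x2) / (norm x1 + norm x2)" .
  have "\<forall>\<^sub>F k in sequentially. t k \<in> itr_values A B xbar \<delta>" if "\<delta> > 0" for \<delta>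
  proof -
    have "\<forall>\<^sub>F k in sequentially. u k \<noteq> 0" "\<forall>\<^sub>F k in sequentially. v k \<noteq> 0"
      using False lim(4,5) by (auto intro: tendsto_imp_eventually_ne)
    moreover have "\<forall>\<^sub>F k in sequentially. dist (a k) xbar < \<delta>" "\<forall>\<^sub>F k in sequentially. dist (b k) xbar < \<delta>"
      "\<forall>\<^sub>F k in sequentially. dist (x k) xbar < \<delta>"
      using lim(1-3) that by (auto intro: tendstoD)
    moreover have "\<forall>\<^sub>F k in sequentially. dist (quot1 (norm (x k - a k)) (norm (x k - b k))) 1 < \<delta>"
      "\<forall>\<^sub>F k in sequentially. dist (quot1 (u k (x k - a k)) (norm (u k) * norm (x k - a k))) 1 < \<delta>"
      "\<forall>\<^sub>F k in sequentially. dist (quot1 (v k (x k - b k)) (norm (v k) * norm (x k - b k))) 1 < \<delta>"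
      using q that by (auto intro: tendstoD)
    ultimately show ?thesis
    proof eventually_elim
      case (elim k)
      have c: "c k > 0" using elim unfolding c_def by (simp add: add_pos_pos)
      have cuv: "norm (c k *\<^sub>R u k) + norm (c k *\<^sub>R v k) = 1"
      proof -
        have "norm (u k) + norm (v k) > 0" using elim by (simp add: add_pos_pos)
        then show ?thesis using c by (simp add: flip: distrib_left) (simp add: c_def)
      qed
      have ratio: "1 - \<delta> < norm (x k - a k) / norm (x k - b k)" "norm (x k - a k) / norm (x k - b k) < 1 + \<delta>"
        using elim(6) mem(3,4)[of k] by (auto simp: quot1_def dist_real_def abs_less_iff)
      have angle_u: "blinfun_apply (c k *\<^sub>R u k) (x k - a k) / (norm (c k *\<^sub>R u k) * norm (x k - a k)) > 1 - \<delta>"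
        using elim(1,7) mem(3)[of k] c
        by (auto simp: quot1_def dist_real_def abs_less_iff blinfun.scaleR_left)
      have angle_v: "blinfun_apply (c k *\<^sub>R v k) (x k - b k) / (norm (c k *\<^sub>R v k) * norm (x k - b k)) > 1 - \<delta>"
        using elim(2,8) mem(4)[of k] c
        by (auto simp: quot1_def dist_real_def abs_less_iff blinfun.scaleR_left)
      show ?case
        unfolding itr_values_def t_def mem_Collect_eq
        using mem[of k] elim(1-5) c cuv ratio angle_u angle_v frechet_normal_cone_scaleR
        by (intro exI[of _ "a k"] exI[of _ "b k"] exI[of _ "x k"]
            exI[of _ "c k *\<^sub>R u k"] exI[of _ "c k *\<^sub>R v k"])
          (auto simp: dist_commute)
    qed
  qed
  from itr_le_limit_of_values[OF t this] c0 show ?thesis by (simp add: field_simps)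
qed

text \<open>The alternative \<open>1\<close> covers the case that there are no admissible tuples for small \<open>\<delta>\<close>, where the
  infimum is \<open>1\<close> by convention and there need not be any normalized pair.\<close>

lemma itr_attained:
  fixes A B :: "'a::real_normed_vector set"
  assumes fin: "\<exists>S :: 'a set. finite S \<and> span S = UNIV"
  shows "itr A B xbar = 1 \<or>
    (\<exists>(x1, x2) \<in> rel_limiting_normals A B xbar.
       norm x1 + norm x2 = 1 \<and> norm (x1 + x2) = itr A B xbar)"
proof (cases "\<exists>\<delta>>0. itr_values A B xbar \<delta> = {}")
  case True
  then obtain \<delta>0 where "\<delta>0 > 0" and \<delta>0: "itr_values A B xbar \<delta>0 = {}" by blast
  have "itr_inf A B xbar \<delta> = 1" if "\<delta> < \<delta>0" for \<delta>
    using itr_values_mono[of \<delta> \<delta>0 A B xbar] that \<delta>0 by (simp add: itr_inf_def)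
  then have "\<forall>\<^sub>F \<delta> in at_right 0. itr_inf A B xbar \<delta> = 1"
    unfolding eventually_at_right_field using \<open>\<delta>0 > 0\<close> by auto
  then have "(itr_inf A B xbar \<longlongrightarrow> 1) (at_right 0)" by (rule tendsto_eventually)
  then have "itr A B xbar = 1"
    using tendsto_unique[OF trivial_limit_at_right_real itr_inf_tendsto_itr] by blast
  then show ?thesis ..
next
  case False
  define d where "d k = inverse (real (Suc k))" for k
  have d_pos: "d k > 0" for k unfolding d_def by simp
  have d_lim: "d \<longlonglongrightarrow> 0" unfolding d_def by (rule LIMSEQ_inverse_real_of_nat)
  have "\<exists>t \<in> itr_values A B xbar (d k). t < itr_inf A B xbar (d k) + d k" for k
    using False d_pos[of k] cInf_less_iff[OF _ bdd_below_itr_values, of A B xbar "d k" "itr_inf A B xbar (d k) + d k"]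
    by (auto simp: itr_inf_def)
  then obtain t where t: "\<And>k. t k \<in> itr_values A B xbar (d k)"
    and t_less: "\<And>k. t k < itr_inf A B xbar (d k) + d k" by metis
  have "\<exists>a b x u v. t k = norm (u + v) \<and>
       a \<in> (A - B) \<inter> ball xbar (d k) \<and> b \<in> (B - A) \<inter> ball xbar (d k) \<and> x \<in> ball xbar (d k) \<and>
       x \<noteq> a \<and> x \<noteq> b \<and>
       1 - d k < norm (x - a) / norm (x - b) \<and> norm (x - a) / norm (x - b) < 1 + d k \<and>
       u \<in> frechet_normal_cone A a - {0} \<and> v \<in> frechet_normal_cone B b - {0} \<and>
       norm u + norm v = 1 \<and>
       blinfun_apply u (x - a) / (norm u * norm (x - a)) > 1 - d k \<and>
       blinfun_apply v (x - b) / (norm v * norm (x - b)) > 1 - d k" for k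
    using t[of k] unfolding itr_values_def mem_Collect_eq .
  then obtain a b x u v where seq: "\<And>k. t k = norm (u k + v k) \<and>
       a k \<in> (A - B) \<inter> ball xbar (d k) \<and> b k \<in> (B - A) \<inter> ball xbar (d k) \<and> x k \<in> ball xbar (d k) \<and>
       x k \<noteq> a k \<and> x k \<noteq> b k \<and>
       1 - d k < norm (x k - a k) / norm (x k - b k) \<and> norm (x k - a k) / norm (x k - b k) < 1 + d k \<and>
       u k \<in> frechet_normal_cone A (a k) - {0} \<and> v k \<in> frechet_normal_cone B (b k) - {0} \<and>
       norm (u k) + norm (v k) = 1 \<and>
       blinfun_apply (u k) (x k - a k) / (norm (u k) * norm (x k - a k)) > 1 - d k \<and>
       blinfun_apply (v k) (x k - b k) / (norm (v k) * norm (x k - b k)) > 1 - d k"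
    by metis
  have to_xbar: "y \<longlonglongrightarrow> xbar" if "\<And>k. y k \<in> ball xbar (d k)" for y
  proof -
    have "dist (y k) xbar \<le> d k" for k using that[of k] by (simp add: dist_commute)
    then show ?thesis
      using d_lim metric_tendsto_imp_tendsto[of d 0 sequentially y xbar] d_pos
      by (simp add: less_imp_le)
  qed
  have to_1: "s \<longlonglongrightarrow> 1" if "\<And>k. 1 - d k < s k" "\<And>k. s k < 1 + d k" for s
  proof (rule tendsto_sandwich)
    show "\<forall>\<^sub>F k in sequentially. 1 - d k \<le> s k" "\<forall>\<^sub>F k in sequentially. s k \<le> 1 + d k"
      by (simp_all add: less_imp_le that)
    show "(\<lambda>k. 1 - d k) \<longlonglongrightarrow> 1" "(\<lambda>k. 1 + d k) \<longlonglongrightarrow> 1"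
      using d_lim by (auto intro!: tendsto_eq_intros)
  qed
  \<comment> \<open>Admissibility bounds the two angle quotients from below only; the operator norm bounds them from
    above.\<close>
  have quotient_less: "w y / (norm w * norm y) < 1 + d k" for w :: "'a \<Rightarrow>\<^sub>L real" and y k
  proof -
    have "w y \<le> norm w * norm y" using norm_blinfun[of w y] by (simp add: abs_le_iff)
    then have "w y / (norm w * norm y) \<le> 1" by (auto simp: divide_le_eq_1 zero_less_mult_iff)
    then show ?thesis using d_pos[of k] by linarith
  qed
  have inf_lim: "(\<lambda>k. itr_inf A B xbar (d k)) \<longlonglongrightarrow> itr A B xbar"
    by (rule filterlim_compose[OF itr_inf_tendsto_itr])
       (simp add: filterlim_at d_lim d_pos less_imp_neq[OF d_pos, THEN not_sym])
  have sum_lim: "(\<lambda>k. norm (u k + v k)) \<longlonglongrightarrow> itr A B xbar"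
  proof (rule tendsto_sandwich[OF _ _ inf_lim])
    show "\<forall>\<^sub>F k in sequentially. itr_inf A B xbar (d k) \<le> norm (u k + v k)"
      using itr_inf_le_value[OF t] seq by simp
    show "\<forall>\<^sub>F k in sequentially. norm (u k + v k) \<le> itr_inf A B xbar (d k) + d k"
      using less_imp_le[OF t_less] seq by simp
    show "(\<lambda>k. itr_inf A B xbar (d k) + d k) \<longlonglongrightarrow> itr A B xbar"
      using inf_lim d_lim by (auto intro!: tendsto_eq_intros)
  qed
  have "norm (u k) \<le> 1" "norm (v k) \<le> 1" for k
    using seq[of k] norm_ge_zero[of "u k"] norm_ge_zero[of "v k"] by linarith+
  then obtain x1 r where r: "strict_mono (r :: nat \<Rightarrow> nat)" and x1: "(\<lambda>k. u (r k)) \<longlonglongrightarrow> x1"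
    using dual_bounded_sequence_has_convergent_subsequence[OF fin] by metis
  obtain x2 q where q: "strict_mono (q :: nat \<Rightarrow> nat)" and x2: "(\<lambda>k. v (r (q k))) \<longlonglongrightarrow> x2"
    using dual_bounded_sequence_has_convergent_subsequence[OF fin, of "\<lambda>k. v (r k)"]
      \<open>\<And>k. norm (v k) \<le> 1\<close> by metis
  define p where "p k = r (q k)" for k
  have p: "strict_mono p" using r q unfolding p_def strict_mono_def by blast
  have sub: "(\<lambda>k. s (p k)) \<longlonglongrightarrow> l" if "s \<longlonglongrightarrow> l" for s :: "nat \<Rightarrow> 'c::topological_space" and l
    using LIMSEQ_subseq_LIMSEQ[OF that p] by (simp add: o_def)
  have up: "(\<lambda>k. u (p k)) \<longlonglongrightarrow> x1"
    using LIMSEQ_subseq_LIMSEQ[OF x1 q] by (simp add: o_def p_def)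
  have vp: "(\<lambda>k. v (p k)) \<longlonglongrightarrow> x2" using x2 by (simp add: p_def)
  have mem: "(x1, x2) \<in> rel_limiting_normals A B xbar"
  proof -
    have ratio: "(\<lambda>k. quot1 (norm (x k - a k)) (norm (x k - b k))) \<longlonglongrightarrow> 1"
      using seq by (intro to_1) (auto simp: quot1_def)
    have angle_u: "(\<lambda>k. quot1 (u k (x k - a k)) (norm (u k) * norm (x k - a k))) \<longlonglongrightarrow> 1"
      using seq quotient_less by (intro to_1) (auto simp: quot1_def)
    have angle_v: "(\<lambda>k. quot1 (v k (x k - b k)) (norm (v k) * norm (x k - b k))) \<longlonglongrightarrow> 1"
      using seq quotient_less by (intro to_1) (auto simp: quot1_def)
    have points: "a \<longlonglongrightarrow> xbar" "b \<longlonglongrightarrow> xbar" "x \<longlonglongrightarrow> xbar"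
      using seq by (auto intro!: to_xbar simp del: mem_ball)
    have "\<forall>k. a (p k) \<in> A - B \<and> b (p k) \<in> B - A \<and> x (p k) \<noteq> a (p k) \<and> x (p k) \<noteq> b (p k) \<and>
        u (p k) \<in> frechet_normal_cone A (a (p k)) \<and> v (p k) \<in> frechet_normal_cone B (b (p k))"
      using seq by simp
    note witness = this sub[OF points(1)] sub[OF points(2)] sub[OF points(3)] up vp
      sub[OF ratio] sub[OF angle_u] sub[OF angle_v]
    show ?thesis
      unfolding rel_limiting_normals_def mem_Collect_eq prod.case
      by (intro exI[of _ "\<lambda>k. a (p k)"] exI[of _ "\<lambda>k. b (p k)"] exI[of _ "\<lambda>k. x (p k)"]
          exI[of _ "\<lambda>k. u (p k)"] exI[of _ "\<lambda>k. v (p k)"] conjI witness)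
  qed
  have "(\<lambda>k. norm (u (p k)) + norm (v (p k))) \<longlonglongrightarrow> norm x1 + norm x2"
    using up vp by (intro tendsto_intros)
  then have "norm x1 + norm x2 = 1" using seq by (simp add: LIMSEQ_const_iff)
  moreover have "norm (x1 + x2) = itr A B xbar"
  proof (rule LIMSEQ_unique)
    show "(\<lambda>k. norm (u (p k) + v (p k))) \<longlonglongrightarrow> norm (x1 + x2)"
      using up vp by (intro tendsto_intros)
    show "(\<lambda>k. norm (u (p k) + v (p k))) \<longlonglongrightarrow> itr A B xbar"
      using sub[OF sum_lim] .
  qed
  ultimately show ?thesis using mem by blast
qed

section \<open>The three equivalent conditions\<close>

lemma norm_add_gt_iff_less_itr:
  fixes A B :: "'a::real_normed_vector set"
  assumes "\<exists>S :: 'a set. finite S \<and> span S = UNIV" and "\<alpha> < 1"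
  shows "(\<forall>(x1, x2) \<in> rel_limiting_normals A B xbar.
            norm x1 + norm x2 = 1 \<longrightarrow> norm (x1 + x2) > \<alpha>) \<longleftrightarrow> \<alpha> < itr A B xbar"
proof
  assume "\<forall>(x1, x2) \<in> rel_limiting_normals A B xbar. norm x1 + norm x2 = 1 \<longrightarrow> norm (x1 + x2) > \<alpha>"
  then show "\<alpha> < itr A B xbar" using itr_attained[OF assms(1), of A B xbar] assms(2) by fastforce
next
  assume "\<alpha> < itr A B xbar"
  then show "\<forall>(x1, x2) \<in> rel_limiting_normals A B xbar. norm x1 + norm x2 = 1 \<longrightarrow> norm (x1 + x2) > \<alpha>"
    using itr_le_norm_add_of_rel_limiting_normals[of _ _ A B xbar] by fastforce
qed

lemma itr_pos_iff_no_opposite_pair: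
  fixes A B :: "'a::real_normed_vector set"
  assumes "\<exists>S :: 'a set. finite S \<and> span S = UNIV"
  shows "itr A B xbar > 0 \<longleftrightarrow> {x'. (x', - x') \<in> rel_limiting_normals A B xbar} \<subseteq> {0}"
proof
  assume pos: "itr A B xbar > 0"
  show "{x'. (x', - x') \<in> rel_limiting_normals A B xbar} \<subseteq> {0}"
  proof clarsimp
    fix x' assume "(x', - x') \<in> rel_limiting_normals A B xbar"
    from itr_le_norm_add_of_rel_limiting_normals[OF this]
    have "itr A B xbar * (2 * norm x') \<le> 0" by simp
    then show "x' = 0" using pos by (simp add: mult_le_0_iff)
  qed
next
  assume opp: "{x'. (x', - x') \<in> rel_limiting_normals A B xbar} \<subseteq> {0}"
  show "itr A B xbar > 0"
  proof (rule ccontr)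
    assume "\<not> ?thesis"
    then have zero: "itr A B xbar = 0" using itr_nonneg[of A B xbar] by simp
    then obtain x1 x2 where x: "(x1, x2) \<in> rel_limiting_normals A B xbar"
      "norm x1 + norm x2 = 1" "norm (x1 + x2) = 0"
      using itr_attained[OF assms, of A B xbar] by force
    then have "x2 = - x1" by (simp add: eq_neg_iff_add_eq_0 add.commute)
    with x opp show False by auto
  qed
qed

theorem theorem5:
  fixes A B :: "'a::real_normed_vector set" and xbar :: 'a
  assumes "\<exists>S :: 'a set. finite S \<and> span S = UNIV"
    and "closed A" and "closed B" and "xbar \<in> A \<inter> B"
  shows "(intrinsically_transversal A B xbar \<longleftrightarrow>
           (\<exists>\<alpha>\<in>{0<..<1}. \<forall>(x1, x2) \<in> rel_limiting_normals A B xbar.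
              norm x1 + norm x2 = 1 \<longrightarrow> norm (x1 + x2) > \<alpha>))
       \<and> ((\<exists>\<alpha>\<in>{0<..<1}. \<forall>(x1, x2) \<in> rel_limiting_normals A B xbar.
              norm x1 + norm x2 = 1 \<longrightarrow> norm (x1 + x2) > \<alpha>) \<longleftrightarrow>
           {x'. (x', - x') \<in> rel_limiting_normals A B xbar} \<subseteq> {0})
       \<and> Sup0 {\<alpha>\<in>{0<..<1}. \<forall>(x1, x2) \<in> rel_limiting_normals A B xbar.
              norm x1 + norm x2 = 1 \<longrightarrow> norm (x1 + x2) > \<alpha>} = itr A B xbar"
proof -
  define L where "L = itr A B xbar"
  define bound where "bound \<alpha> \<longleftrightarrow> (\<forall>(x1, x2) \<in> rel_limiting_normals A B xbar.
      norm x1 + norm x2 = 1 \<longrightarrow> norm (x1 + x2) > \<alpha>)" for \<alpha>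
  have L: "0 \<le> L" "L \<le> 1" unfolding L_def by (rule itr_nonneg, rule itr_le_1)
  have "bound \<alpha> \<longleftrightarrow> \<alpha> < L" if "\<alpha> < 1" for \<alpha>
    using norm_add_gt_iff_less_itr[OF assms(1) that] unfolding bound_def L_def .
  then have S: "{\<alpha>\<in>{0<..<1}. bound \<alpha>} = {0<..<L}" using L(2) by auto
  have "(\<exists>\<alpha>\<in>{0<..<1}. bound \<alpha>) \<longleftrightarrow> {\<alpha>\<in>{0<..<1}. bound \<alpha>} \<noteq> {}" by blast
  then have ii: "(\<exists>\<alpha>\<in>{0<..<1}. bound \<alpha>) \<longleftrightarrow> L > 0"
    unfolding S by (simp add: not_le)
  have iii: "L > 0 \<longleftrightarrow> {x'. (x', - x') \<in> rel_limiting_normals A B xbar} \<subseteq> {0}"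
    unfolding L_def by (rule itr_pos_iff_no_opposite_pair[OF assms(1)])
  have "Sup0 {\<alpha>\<in>{0<..<1}. bound \<alpha>} = L" unfolding S Sup0_def using L(1) by auto
  then show ?thesis
    using ii iii unfolding bound_def[symmetric] intrinsically_transversal_def L_def[symmetric] by simp
qed

end
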